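(* Let $R$ be a finite ring and let $p_1,\dots,p_n$ be the distinct primes dividing $|R|$. Then for every integer $k\ge 1$, $$|\mathcal{I}_{k+1}(R)|\le \frac{(k+1)^n}{\prod_{i=1}^n p_i}\,|R|^{\frac{2k}{k+1}},$$ where $\mathcal{I}_{k+1}(R)=\{x\in R: x^{k+1}=x\}$ is the set of $(k+1)$-potent elements of $R$. *)

theory Defs
  imports Complex_Main "HOL-Algebra.Ring" "HOL-Algebra.Coset" "HOL-Computational_Algebra.Primes"
begin

definition potents :: "('a, 'b) ring_scheme \<Rightarrow> nat \<Rightarrow> 'a set" where
  "potents R m = {x \<in> carrier R. x [^]\<^bsub>R\<^esub> m = x}"

end

theory Submission
  imports Defs "HOL-Algebra.Sylow" "HOL-Algebra.Multiplicative_Group"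
begin

text \<open>
  Since \<open>2k / (k + 1) \<ge> 1\<close>, it suffices to bound the number of potents by
  \<open>(k + 1)\<^sup>n |R| / P\<close>, where \<open>P\<close> is the product of the primes dividing \<open>|R|\<close>. Double counting the
  pairs \<open>(c, x)\<close> with \<open>0 \<le> c < P\<close> and \<open>x + c\<close> potent reduces this to showing that, for each \<open>x\<close>, at
  most \<open>(k + 1)\<^sup>n\<close> of these \<open>c\<close> occur, and by the Chinese remainder theorem to showing that they
  occupy at most \<open>k + 1\<close> residue classes modulo each prime \<open>q\<close> dividing \<open>|R|\<close>. Given \<open>k + 2\<close> such
  \<open>c\<close> that are pairwise incongruent modulo \<open>q\<close>, a divided difference of the monic polynomial
  \<open>t\<^bsup>k+1\<^esup> - t\<close> at the points \<open>x + c\<close> gives \<open>D \<cdot> 1 = 0\<close> in \<open>R\<close> for an integer \<open>D\<close> prime to \<open>q\<close>,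
  which contradicts Cauchy's theorem for the additive group.
\<close>

section \<open>Divided differences over the integers\<close>

text \<open>The weights \<open>w\<close> are those of the divided difference at the nodes \<open>A\<close>, cleared of denominators.\<close>

lemma divided_difference_weights:
  fixes q :: int and A :: "int set"
  assumes "prime q" "finite A" "A \<noteq> {}" "inj_on (\<lambda>a. a mod q) A"
  shows "\<exists>w D. \<not> q dvd D \<and> (\<Sum>a\<in>A. w a * a ^ (card A - 1)) = D \<and>
    (\<forall>l < card A - 1. (\<Sum>a\<in>A. w a * a ^ l) = 0)"
  using assms(2-4)
proof (induction A rule: finite_ne_induct)
  case (singleton b)
  have "\<not> q dvd 1"
    using \<open>prime q\<close> not_prime_unit by blast
  then show ?case
    by (intro exI[of _ "\<lambda>_. 1"] exI[of _ 1]) simp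
next
  case (insert b B)
  then obtain w D where D: "\<not> q dvd D" "(\<Sum>a\<in>B. w a * a ^ (card B - 1)) = D"
    and w: "\<And>l. l < card B - 1 \<Longrightarrow> (\<Sum>a\<in>B. w a * a ^ l) = 0"
    by (auto simp: inj_on_insert)
  have cB: "card B > 0"
    using insert by (simp add: card_gt_0_iff)
  \<comment> \<open>Adjoining the node \<open>b\<close> divides each old weight \<open>w a\<close>
    by \<open>a - b\<close>; the factor \<open>E\<close> keeps the quotients \<open>v a\<close>
    integral and is itself prime to \<open>q\<close>. The weight at \<open>b\<close> is chosen so
    that all weights sum to zero.\<close>
  define E where "E = (\<Prod>a\<in>B. a - b)"
  define v where "v a = w a * (\<Prod>a'\<in>B - {a}. a' - b)" for a
  define u where "u = (\<lambda>a. if a = b then - sum v B else v a)"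
  have v: "v a * (a - b) = w a * E" if "a \<in> B" for a
    using insert.hyps that unfolding E_def v_def by (simp add: prod.remove[of B a])
  have "\<not> q dvd a - b" if "a \<in> B" for a
  proof -
    have "a \<noteq> b"
      using that insert.hyps by blast
    then have "a mod q \<noteq> b mod q"
      using that inj_onD[OF insert.prems] by blast
    then show ?thesis
      by (simp add: mod_eq_dvd_iff)
  qed
  then have E: "\<not> q dvd E"
    unfolding E_def using \<open>prime q\<close> insert.hyps by (simp add: prime_dvd_prod_iff)
  \<comment> \<open>By the factorization of \<open>a ^ l - b ^ l\<close>, a power sum of
    \<open>u\<close> involves only power sums of \<open>w\<close> of degree below \<open>l\<close>.
    For \<open>l < card B\<close> these all vanish; for \<open>l = card B\<close> only the top one
    survives, with coefficient 1, and gives \<open>E * D\<close>.\<close>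
  have u: "(\<Sum>a\<in>insert b B. u a * a ^ l)
      = E * (\<Sum>i<l. b ^ (l - Suc i) * (\<Sum>a\<in>B. w a * a ^ i))" for l
  proof -
    have "(\<Sum>a\<in>insert b B. u a * a ^ l) = - sum v B * b ^ l + (\<Sum>a\<in>B. v a * a ^ l)"
    proof -
      have "(\<Sum>a\<in>B. u a * a ^ l) = (\<Sum>a\<in>B. v a * a ^ l)"
        using insert.hyps by (intro sum.cong) (auto simp: u_def)
      then show ?thesis
        using insert.hyps by (simp add: u_def)
    qed
    also have "\<dots> = (\<Sum>a\<in>B. v a * (a ^ l - b ^ l))"
      by (simp add: algebra_simps sum_subtractf sum_distrib_left sum_distrib_right)
    also have "\<dots> = (\<Sum>a\<in>B. w a * E * (\<Sum>i<l. b ^ (l - Suc i) * a ^ i))"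
      by (intro sum.cong refl) (simp add: power_diff_sumr2 v flip: mult.assoc)
    also have "\<dots> = (\<Sum>a\<in>B. \<Sum>i<l. E * (b ^ (l - Suc i) * (w a * a ^ i)))"
      by (simp add: sum_distrib_left algebra_simps)
    also have "\<dots> = (\<Sum>i<l. \<Sum>a\<in>B. E * (b ^ (l - Suc i) * (w a * a ^ i)))"
      by (rule sum.swap)
    finally show ?thesis
      by (simp add: sum_distrib_left)
  qed
  have "(\<Sum>a\<in>insert b B. u a * a ^ card B) = E * D"
  proof -
    obtain m where m: "card B = Suc m"
      using cB gr0_conv_Suc by blast
    then show ?thesis
      unfolding u using D w by simp
  qed
  moreover have "(\<Sum>a\<in>insert b B. u a * a ^ l) = 0" if "l < card B" for l
    unfolding u using that w by simp
  moreover have "\<not> q dvd E * D"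
    using E D \<open>prime q\<close> by (simp add: prime_dvd_mult_iff)
  moreover have "card (insert b B) - 1 = card B"
    using insert.hyps by simp
  ultimately show ?case
    by metis
qed

section \<open>Divided differences and additive torsion in the ring\<close>

context ring
begin

lemma add_pow_int_zero [simp]: "[(0::int)] \<cdot> a = \<zero>"
  by (simp add: add_pow_def)

lemma finsum_add_pow_one:
  fixes v :: "'i \<Rightarrow> int"
  assumes "finite A"
  shows "(\<Oplus>a\<in>A. [v a] \<cdot> \<one>) = [(\<Sum>a\<in>A. v a)] \<cdot> \<one>"
  using assms
proof (induction A rule: finite_induct)
  case empty
  then show ?case
    by simp
next
  case (insert b B)
  then show ?case
    by (simp add: add.int_pow_mult)
qed

text \<open>For divided difference weights and \<open>l = 0\<close> this is the cleared divided
  difference of \<open>t ^ i\<close> at the translates of \<open>x\<close>. The extra index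
  \<open>l\<close> lets a recursion on \<open>i\<close> close up: splitting one factor into
  \<open>x\<close> plus a multiple of 1 moves that multiple into the coefficient.\<close>

definition weighted_power_sum :: "int set \<Rightarrow> (int \<Rightarrow> int) \<Rightarrow> 'a \<Rightarrow> nat \<Rightarrow> nat \<Rightarrow> 'a" where
  "weighted_power_sum A w x i l = (\<Oplus>a\<in>A. [(w a * a ^ l)] \<cdot> ((x \<oplus> [a] \<cdot> \<one>) [^] i))"

lemma weighted_power_sum_Suc:
  assumes "finite A" "x \<in> carrier R"
  shows "weighted_power_sum A w x (Suc i) l
    = weighted_power_sum A w x i l \<otimes> x \<oplus> weighted_power_sum A w x i (Suc l)"
proof -
  have "[(w a * a ^ l)] \<cdot> ((x \<oplus> [a] \<cdot> \<one>) [^] Suc i)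
      = ([(w a * a ^ l)] \<cdot> ((x \<oplus> [a] \<cdot> \<one>) [^] i)) \<otimes> x
        \<oplus> [(w a * a ^ Suc l)] \<cdot> ((x \<oplus> [a] \<cdot> \<one>) [^] i)" for a
  proof -
    define y where "y = (x \<oplus> [a] \<cdot> \<one>) [^] i"
    have y: "y \<in> carrier R"
      unfolding y_def using assms by simp
    have "(x \<oplus> [a] \<cdot> \<one>) [^] Suc i = y \<otimes> x \<oplus> [a] \<cdot> y"
      using assms y by (simp add: y_def[symmetric] r_distr add_pow_rdistr_int)
    then show ?thesis
      using assms y
      by (simp add: y_def[symmetric] add.int_pow_distrib add_pow_ldistr_int add.int_pow_pow ac_simps)
  qed
  then have "weighted_power_sum A w x (Suc i) l
      = (\<Oplus>a\<in>A. ([(w a * a ^ l)] \<cdot> ((x \<oplus> [a] \<cdot> \<one>) [^] i)) \<otimes> x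
        \<oplus> [(w a * a ^ Suc l)] \<cdot> ((x \<oplus> [a] \<cdot> \<one>) [^] i))"
    unfolding weighted_power_sum_def by presburger
  then show ?thesis
    unfolding weighted_power_sum_def using assms
    by (simp add: finsum_addf finsum_ldistr Pi_def)
qed

text \<open>Induction on \<open>i\<close>: of the two terms of the recursion, the one multiplied by
  \<open>x\<close> has total degree \<open>i + l\<close> below \<open>m\<close> and vanishes, while
  the other keeps the total degree. At \<open>i = 0\<close> only the integer power sums
  remain.\<close>

lemma weighted_power_sum_eq:
  assumes "finite A" "x \<in> carrier R"
    and "(\<Sum>a\<in>A. w a * a ^ m) = D" and "\<And>l. l < m \<Longrightarrow> (\<Sum>a\<in>A. w a * a ^ l) = 0"
    and "i + l \<le> m"
  shows "weighted_power_sum A w x i l = (if i + l = m then [D] \<cdot> \<one> else \<zero>)"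
  using assms(5)
proof (induction i arbitrary: l)
  case 0
  then show ?case
    using assms by (simp add: weighted_power_sum_def finsum_add_pow_one)
next
  case (Suc i)
  then show ?case
    using assms by (simp add: weighted_power_sum_Suc)
qed

text \<open>By Cauchy's theorem some nonzero \<open>y\<close> is killed by \<open>q\<close>. It is
  also killed by \<open>D\<close>, because \<open>[D] \<cdot> y\<close> is the product of
  \<open>[D] \<cdot> \<one>\<close> and \<open>y\<close>. If \<open>q\<close> and \<open>D\<close>
  were coprime, a Bezout relation would force \<open>y\<close> to be zero.\<close>

lemma add_pow_one_eq_zero_imp_dvd:
  fixes D :: int and q :: nat
  assumes "finite (carrier R)" "prime q" "q dvd order R" "[D] \<cdot> \<one> = \<zero>"
  shows "int q dvd D"
proof (rule ccontr)
  assume "\<not> int q dvd D"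
  then have "coprime (int q) D"
    using \<open>prime q\<close> by (simp add: prime_imp_coprime)
  then obtain s t where st: "s * int q + t * D = 1"
    using bezout_int[of "int q" D] by auto
  have ord: "order (add_monoid R) = order R"
    by (simp add: order_def)
  obtain m where "order (add_monoid R) = q ^ 1 * m"
    using assms ord by auto
  \<comment> \<open>With exponent 1, where \<open>q\<close> may still divide \<open>m\<close>,
    Sylow's theorem becomes Cauchy's.\<close>
  then obtain H where H: "subgroup H (add_monoid R)" "card H = q"
    using sylow_thm[of q "add_monoid R" 1 m] assms a_group by auto
  have "\<exists>y\<in>H. y \<noteq> \<zero>"
  proof (rule ccontr)
    assume "\<not> ?thesis"
    then have "H \<subseteq> {\<zero>}"
      by blast
    then have "card H \<le> 1"
      using card_mono[of "{\<zero>}" H] by simp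
    then show False
      using H prime_gt_1_nat[OF \<open>prime q\<close>] by simp
  qed
  then obtain y where y: "y \<in> H" "y \<noteq> \<zero>"
    by blast
  then have yR: "y \<in> carrier R"
    using H subgroup.mem_carrier by fastforce
  have Dy: "[D] \<cdot> y = \<zero>"
    using add_pow_ldistr_int[of \<one> y D] assms yR by simp
  have qy: "[int q] \<cdot> y = \<zero>"
  proof -
    interpret H: group "(add_monoid R)\<lparr>carrier := H\<rparr>"
      using subgroup.subgroup_is_group[OF H(1) a_group] .
    have "y [^]\<^bsub>(add_monoid R)\<lparr>carrier := H\<rparr>\<^esub> order ((add_monoid R)\<lparr>carrier := H\<rparr>) = \<zero>"
      using H.pow_order_eq_1[of y] y by simp
    then show ?thesis
      using H(2) add.nat_pow_consistent by (simp add: order_def add_pow_def int_pow_int nat_pow_def)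
  qed
  have "y = [(s * int q + t * D)] \<cdot> y"
    using yR by (simp add: st)
  also have "\<dots> = [s] \<cdot> ([int q] \<cdot> y) \<oplus> [t] \<cdot> ([D] \<cdot> y)"
    using yR by (simp add: add.int_pow_mult add.int_pow_pow mult.commute)
  also have "\<dots> = \<zero>"
    by (simp add: Dy qy)
  finally show False
    using y by simp
qed

lemma card_residues_potent_translates:
  fixes q k :: nat
  assumes "finite (carrier R)" "prime q" "q dvd order R" "k \<ge> 1" "x \<in> carrier R"
  shows "card ((\<lambda>c. c mod int q) ` {c. x \<oplus> [c] \<cdot> \<one> \<in> potents R (k + 1)}) \<le> k + 1"
proof (rule ccontr)
  let ?C = "{c. x \<oplus> [c] \<cdot> \<one> \<in> potents R (k + 1)}"
  assume "\<not> ?thesis"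
  then have "k + 2 \<le> card ((\<lambda>c. c mod int q) ` ?C)"
    by simp
  then obtain B where B: "B \<subseteq> (\<lambda>c. c mod int q) ` ?C" "card B = k + 2" "finite B"
    using obtain_subset_with_card_n by metis
  \<comment> \<open>One integer is picked from each of \<open>k + 2\<close> residue classes, so that
    \<open>card A - 1\<close> is the degree \<open>k + 1\<close>.\<close>
  then obtain A where A: "A \<subseteq> ?C" "inj_on (\<lambda>c. c mod int q) A" "B = (\<lambda>c. c mod int q) ` A"
    using subset_image_inj[of B] by metis
  have cardA: "card A = k + 2" and finA: "finite A"
    using A B by (auto simp: card_image finite_image_iff)
  then have "A \<noteq> {}"
    by auto
  then obtain w D where D: "\<not> int q dvd D" "(\<Sum>a\<in>A. w a * a ^ (k + 1)) = D"
    and w: "\<And>l. l < k + 1 \<Longrightarrow> (\<Sum>a\<in>A. w a * a ^ l) = 0"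
    using divided_difference_weights[of "int q" A] A finA cardA \<open>prime q\<close> by auto
  \<comment> \<open>Potency makes the sums agree term by term. The left one is
    \<open>[D] \<cdot> \<one>\<close>; the right one is zero, as \<open>1 < k + 1\<close>.\<close>
  have "weighted_power_sum A w x (k + 1) 0 = weighted_power_sum A w x 1 0"
    unfolding weighted_power_sum_def using A assms
    by (intro finsum_cong') (auto simp: potents_def subset_iff)
  then have "[D] \<cdot> \<one> = \<zero>"
    using weighted_power_sum_eq[where w = w, OF finA \<open>x \<in> carrier R\<close> D(2) w] \<open>k \<ge> 1\<close> by simp
  then show False
    using add_pow_one_eq_zero_imp_dvd assms D by blast
qed

end

section \<open>Counting integers by their residues\<close>

lemma prod_dvd_of_pairwise_coprime:
  fixes f :: "'i \<Rightarrow> 'b::semiring_gcd"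
  assumes "finite I" "\<And>i. i \<in> I \<Longrightarrow> f i dvd d"
    and "\<And>i j. i \<in> I \<Longrightarrow> j \<in> I \<Longrightarrow> i \<noteq> j \<Longrightarrow> coprime (f i) (f j)"
  shows "(\<Prod>i\<in>I. f i) dvd d"
  using assms
proof (induction I rule: finite_induct)
  case empty
  then show ?case
    by simp
next
  case (insert i I)
  then have "coprime (f i) (\<Prod>j\<in>I. f j)"
    by (intro prod_coprime_right) auto
  then show ?case
    using insert by (simp add: divides_mult)
qed

text \<open>By the Chinese remainder theorem, an integer in an interval as long as the product of
  the primes is determined by its tuple of residues, and there are at most \<open>m\<close> choices
  for each entry.\<close>

lemma card_le_of_card_residues_le:
  fixes p :: "'i \<Rightarrow> nat" and C :: "int set"
  assumes "finite I" and "inj_on p I" and "\<And>i. i \<in> I \<Longrightarrow> prime (p i)"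
    and C: "C \<subseteq> {0..<(\<Prod>i\<in>I. int (p i))}"
    and card: "\<And>i. i \<in> I \<Longrightarrow> card ((\<lambda>c. c mod int (p i)) ` C) \<le> m"
  shows "card C \<le> m ^ card I"
proof -
  have "finite C"
    using C finite_subset by blast
  let ?F = "\<lambda>c. \<lambda>i\<in>I. c mod int (p i)"
  let ?T = "PiE I (\<lambda>i. (\<lambda>c. c mod int (p i)) ` C)"
  have "inj_on ?F C"
  proof (rule inj_onI)
    fix c d assume cd: "c \<in> C" "d \<in> C" "?F c = ?F d"
    have "int (p i) dvd c - d" if "i \<in> I" for i
      using fun_cong[OF cd(3), of i] that by (simp add: mod_eq_dvd_iff)
    moreover have "coprime (int (p i)) (int (p j))" if "i \<in> I" "j \<in> I" "i \<noteq> j" for i j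
      using that assms(2,3) inj_onD[OF assms(2), of i j] by (auto intro: primes_coprime)
    ultimately have "(\<Prod>i\<in>I. int (p i)) dvd c - d"
      using \<open>finite I\<close> by (intro prod_dvd_of_pairwise_coprime) auto
    then have "c mod (\<Prod>i\<in>I. int (p i)) = d mod (\<Prod>i\<in>I. int (p i))"
      by (simp add: mod_eq_dvd_iff)
    moreover have "c mod (\<Prod>i\<in>I. int (p i)) = c" "d mod (\<Prod>i\<in>I. int (p i)) = d"
      using cd(1,2) C by auto
    ultimately show "c = d"
      by simp
  qed
  moreover have "?F ` C \<subseteq> ?T"
    by auto
  moreover have "finite ?T"
    using \<open>finite I\<close> \<open>finite C\<close> by (intro finite_PiE) auto
  ultimately have "card C \<le> card ?T"
    using card_inj_on_le by blast
  also have "\<dots> = (\<Prod>i\<in>I. card ((\<lambda>c. c mod int (p i)) ` C))"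
    using \<open>finite I\<close> by (rule card_PiE)
  also have "\<dots> \<le> (\<Prod>i\<in>I. m)"
    using card by (intro prod_mono) auto
  finally show ?thesis
    by simp
qed

section \<open>Double counting and the final bound\<close>

lemma (in ring) card_translate_vimage:
  assumes "S \<subseteq> carrier R" "u \<in> carrier R"
  shows "card {x \<in> carrier R. x \<oplus> u \<in> S} = card S"
proof (rule bij_betw_same_card[of "\<lambda>x. x \<oplus> u"])
  have "s \<in> (\<lambda>x. x \<oplus> u) ` {x \<in> carrier R. x \<oplus> u \<in> S}" if "s \<in> S" for s
  proof (rule image_eqI[of _ _ "s \<ominus> u"])
    show "s = s \<ominus> u \<oplus> u"
      using that assms by (simp add: subset_iff a_minus_def a_assoc l_neg)
    then show "s \<ominus> u \<in> {x \<in> carrier R. x \<oplus> u \<in> S}"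
      using that assms by auto
  qed
  then show "bij_betw (\<lambda>x. x \<oplus> u) {x \<in> carrier R. x \<oplus> u \<in> S} S"
    using assms by (auto simp: bij_betw_def inj_on_def)
qed

lemma (in ring) card_potents_mult_primes_le:
  fixes p :: "'i \<Rightarrow> nat"
  assumes "finite (carrier R)" "k \<ge> 1" "finite I" "inj_on p I"
    and p: "\<And>i. i \<in> I \<Longrightarrow> prime (p i) \<and> p i dvd order R"
  shows "(\<Prod>i\<in>I. p i) * card (potents R (k + 1)) \<le> (k + 1) ^ card I * order R"
proof -
  let ?S = "potents R (k + 1)"
  define N where "N = (\<Prod>i\<in>I. p i)"
  let ?C = "{0..<int N}"
  have N: "int N = (\<Prod>i\<in>I. int (p i))"
    by (simp add: N_def)
  \<comment> \<open>Each of the \<open>N\<close> translations is a bijection of the ring, so every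
    summand equals \<open>card ?S\<close>.\<close>
  have "N * card ?S = (\<Sum>c\<in>?C. card {x \<in> carrier R. x \<oplus> [c] \<cdot> \<one> \<in> ?S})"
  proof -
    have "?S \<subseteq> carrier R"
      by (auto simp: potents_def)
    then show ?thesis
      by (simp add: card_translate_vimage)
  qed
  also have "\<dots> = (\<Sum>x\<in>carrier R. card {c \<in> ?C. x \<oplus> [c] \<cdot> \<one> \<in> ?S})"
    using \<open>finite (carrier R)\<close> by (intro sum_multicount_gen) auto
  also have "\<dots> \<le> (\<Sum>x\<in>carrier R. (k + 1) ^ card I)"
  proof (intro sum_mono card_le_of_card_residues_le)
    fix x i assume x: "x \<in> carrier R" and i: "i \<in> I"
    let ?T = "{c. x \<oplus> [c] \<cdot> \<one> \<in> ?S}"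
    \<comment> \<open>\<open>?T\<close> ranges over all integers, so finiteness of its residues must
      be secured before cardinalities can be compared by inclusion.\<close>
    have "finite ((\<lambda>c. c mod int (p i)) ` ?T)"
    proof (rule finite_subset)
      show "(\<lambda>c. c mod int (p i)) ` ?T \<subseteq> {0..<int (p i)}"
        using p[OF i] prime_gt_0_nat by auto
    qed simp
    then have "card ((\<lambda>c. c mod int (p i)) ` {c \<in> ?C. x \<oplus> [c] \<cdot> \<one> \<in> ?S})
        \<le> card ((\<lambda>c. c mod int (p i)) ` ?T)"
      by (rule card_mono) auto
    also have "\<dots> \<le> k + 1"
      using card_residues_potent_translates assms(1,2) p[OF i] x by blast
    finally show "card ((\<lambda>c. c mod int (p i)) ` {c \<in> ?C. x \<oplus> [c] \<cdot> \<one> \<in> ?S}) \<le> k + 1" .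
  qed (use assms N in auto)
  finally show ?thesis
    by (simp add: N_def order_def mult.commute)
qed

theorem theorem3:
  fixes R :: "('a, 'b) ring_scheme" and p :: "nat \<Rightarrow> nat" and n k :: nat
  assumes "ring R" and "finite (carrier R)"
    and "bij_betw p {1..n} {q. prime q \<and> q dvd order R}"
    and "k \<ge> 1"
  shows "real (card (potents R (k + 1)))
    \<le> (real k + 1) ^ n / (\<Prod>i = 1..n. real (p i))
        * real (order R) powr (2 * real k / (real k + 1))"
proof -
  interpret ring R
    by fact
  let ?P = "\<Prod>i = 1..n. p i"
  have p: "prime (p i) \<and> p i dvd order R" if "i \<in> {1..n}" for i
    using that assms(3) by (auto simp: bij_betw_def)
  have "?P * card (potents R (k + 1)) \<le> (k + 1) ^ n * order R"
    using card_potents_mult_primes_le[of k "{1..n}" p] p assms by (simp add: bij_betw_def)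
  then have "real (?P * card (potents R (k + 1))) \<le> real ((k + 1) ^ n * order R)"
    by (rule of_nat_mono)
  then have le: "real ?P * real (card (potents R (k + 1))) \<le> (real k + 1) ^ n * real (order R)"
    by (simp add: add.commute)
  have P: "real ?P > 0"
    unfolding of_nat_0_less_iff using p prime_gt_0_nat by (intro prod_pos) blast
  \<comment> \<open>The carrier is finite and nonempty; a base of at least 1 makes
    \<open>powr\<close> monotone in the exponent.\<close>
  have order: "real (order R) \<ge> 1"
    using assms(2) by (simp add: order_def Suc_le_eq card_gt_0_iff) blast
  have "real (order R) = real (order R) powr 1"
    using order by simp
  also have "\<dots> \<le> real (order R) powr (2 * real k / (real k + 1))"
    using order \<open>k \<ge> 1\<close> by (intro powr_mono) (auto simp: field_simps)
  finally have powr: "real (order R) \<le> real (order R) powr (2 * real k / (real k + 1))" .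
  have "real (card (potents R (k + 1))) \<le> (real k + 1) ^ n / real ?P * real (order R)"
    using le P by (simp add: field_simps)
  also have "\<dots> \<le> (real k + 1) ^ n / real ?P * real (order R) powr (2 * real k / (real k + 1))"
    using P by (intro mult_left_mono powr) simp
  finally show ?thesis
    by simp
qed

end
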